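(* For every connected complete multipartite graph $H$ (with at least three nodes, of constant size) and every $r \geq 1$, the $r$-round bandwidth complexity of $\textsc{MemList}(H)$ under any single type of topological change (node insertions, node deletions, edge insertions, or edge deletions) is $O(n/r)$.
   Context: A graph is complete multipartite if its node set can be partitioned into independent sets $S_1,\dots,S_k$ such that two nodes are adjacent iff they lie in different parts. Dynamic network model: a sequence of graphs $G^0, G^1, \ldots$ on $n$ nodes, each obtained from the previous by at most one topological change of the allowed type; nodes have distinct IDs from $[n]$, know their neighbors' IDs and initially the whole of $G^0$; communication is synchronous, each round the change happens first, then each node sends a $B$-bit message to each neighbor ($B$ = bandwidth); nodes detect changes only via their neighbor lists; algorithms are deterministic. An $r$-round algorithm works under the promise that each change at round $i$ is followed by $r-1$ change-free rounds and must output correctly for $G^i$ by the end of round $i+r-1$. The $r$-round bandwidth complexity is the minimum such $B$. $\textsc{MemList}(H)$: each node $v$ lists all subgraphs of the current graph isomorphic to $H$ that contain $v$.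
   Formalization: The bound O(n/r) is stated as O(max(1, n/r)), with one constant for all n and r: when r is much larger than n, the literal bound would demand zero bits, which fails, e.g., for the three-node path under edge insertions; for r ≤ n it is exactly O(n/r). *)

theory Defs
  imports Main "HOL-Library.Extended_Real" "HOL-Library.Disjoint_Sets"
begin

section \<open>Finite simple graphs\<close>

type_synonym 'a ugraph = "'a set \<times> 'a set set"

abbreviation verts :: "'a ugraph \<Rightarrow> 'a set" where "verts \<equiv> fst"
abbreviation edges :: "'a ugraph \<Rightarrow> 'a set set" where "edges \<equiv> snd"

definition simple_graph :: "'a ugraph \<Rightarrow> bool" where
  "simple_graph G \<longleftrightarrow> finite (verts G) \<and> (\<forall>e\<in>edges G. e \<subseteq> verts G \<and> card e = 2)"

definition adjacent :: "'a ugraph \<Rightarrow> 'a \<Rightarrow> 'a \<Rightarrow> bool" where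
  "adjacent G u v \<longleftrightarrow> {u, v} \<in> edges G"

definition nbrs :: "'a ugraph \<Rightarrow> 'a \<Rightarrow> 'a set" where
  "nbrs G v = {u. adjacent G u v}"

definition graph_connected :: "'a ugraph \<Rightarrow> bool" where
  "graph_connected G \<longleftrightarrow> (\<forall>u\<in>verts G. \<forall>v\<in>verts G. (adjacent G)\<^sup>*\<^sup>* u v)"

text \<open>The members of \<open>P\<close> are automatically independent (take \<open>u\<close> and \<open>v\<close> in the same part).\<close>

definition complete_multipartite :: "'a ugraph \<Rightarrow> bool" where
  "complete_multipartite G \<longleftrightarrow>
     (\<exists>P. partition_on (verts G) P \<and>
          (\<forall>u\<in>verts G. \<forall>v\<in>verts G. adjacent G u v \<longleftrightarrow> \<not> (\<exists>S\<in>P. u \<in> S \<and> v \<in> S)))"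

text \<open>Subgraphs need not be induced.\<close>

definition is_subgraph :: "'a ugraph \<Rightarrow> 'a ugraph \<Rightarrow> bool" where
  "is_subgraph S G \<longleftrightarrow> simple_graph S \<and> verts S \<subseteq> verts G \<and> edges S \<subseteq> edges G"

definition graph_iso :: "'a ugraph \<Rightarrow> 'b ugraph \<Rightarrow> bool" where
  "graph_iso G H \<longleftrightarrow>
     (\<exists>f. bij_betw f (verts G) (verts H) \<and>
          (\<forall>u\<in>verts G. \<forall>v\<in>verts G. adjacent G u v \<longleftrightarrow> adjacent H (f u) (f v)))"

section \<open>Dynamic networks\<close>

datatype change_type = Node_Insertion | Node_Deletion | Edge_Insertion | Edge_Deletion

fun topological_change :: "change_type \<Rightarrow> 'a ugraph \<Rightarrow> 'a ugraph \<Rightarrow> bool" where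
  "topological_change Node_Insertion G G' \<longleftrightarrow>
     (\<exists>v N. v \<notin> verts G \<and> N \<subseteq> verts G \<and>
            G' = (insert v (verts G), edges G \<union> {{u, v} | u. u \<in> N}))"
| "topological_change Node_Deletion G G' \<longleftrightarrow>
     (\<exists>v\<in>verts G. G' = (verts G - {v}, {e \<in> edges G. v \<notin> e}))"
| "topological_change Edge_Insertion G G' \<longleftrightarrow>
     (\<exists>u\<in>verts G. \<exists>v\<in>verts G. u \<noteq> v \<and> {u, v} \<notin> edges G \<and>
            G' = (verts G, insert {u, v} (edges G)))"
| "topological_change Edge_Deletion G G' \<longleftrightarrow>
     (\<exists>e\<in>edges G. G' = (verts G, edges G - {e}))"

text \<open>
  Nodes are identified with their IDs. Node insertions and deletions change the number of nodes,
  so \<open>n\<close> is the size of the ID space: the current node set is always contained in \<open>{1..n}\<close>.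
  \<open>G i\<close> for \<open>i \<ge> 1\<close> is the graph during round \<open>i\<close>, after the change of that round.
\<close>

definition dynamic_network :: "change_type \<Rightarrow> nat \<Rightarrow> (nat \<Rightarrow> nat ugraph) \<Rightarrow> bool" where
  "dynamic_network T n G \<longleftrightarrow>
     simple_graph (G 0) \<and> (\<forall>i. verts (G i) \<subseteq> {1..n}) \<and>
     (\<forall>i. G (Suc i) = G i \<or> topological_change T (G i) (G (Suc i)))"

definition change_at :: "(nat \<Rightarrow> 'a ugraph) \<Rightarrow> nat \<Rightarrow> bool" where
  "change_at G i \<longleftrightarrow> i \<ge> 1 \<and> G i \<noteq> G (i - 1)"

definition quiet_after :: "nat \<Rightarrow> (nat \<Rightarrow> 'a ugraph) \<Rightarrow> nat \<Rightarrow> bool" where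
  "quiet_after r G i \<longleftrightarrow> (\<forall>j\<in>{i+1..i+r-1}. \<not> change_at G j)"

definition promise :: "nat \<Rightarrow> (nat \<Rightarrow> 'a ugraph) \<Rightarrow> bool" where
  "promise r G \<longleftrightarrow> (\<forall>i. change_at G i \<longrightarrow> quiet_after r G i)"

section \<open>Deterministic distributed algorithms\<close>

text \<open>
  Local computation is unrestricted, so the local state of a node is taken to be everything it
  has observed: its ID, the initial graph (\<open>None\<close> for a node inserted later, which does not know
  \<open>G 0\<close>), and, for every completed round since it joined, its neighbor list in that round
  and the messages received from those neighbors. There is no other access to changes or to a
  global clock.
\<close>

type_synonym message = "bool list"
type_synonym observation = "nat set \<times> (nat \<Rightarrow> message option)"

datatype local_view =
  Local_View (own_id: nat) (initial_graph: "nat ugraph option") (history: "observation list")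

text \<open>
  \<open>send A s N u\<close> is the message sent to the neighbor \<open>u\<close> by a node that has local view \<open>s\<close> at
  the start of the round and neighbor list \<open>N\<close> after the change of the round.
\<close>

record algorithm =
  send :: "local_view \<Rightarrow> nat set \<Rightarrow> nat \<Rightarrow> message"
  result :: "local_view \<Rightarrow> nat ugraph set"

definition has_bandwidth :: "algorithm \<Rightarrow> nat \<Rightarrow> bool" where
  "has_bandwidth A B \<longleftrightarrow> (\<forall>s N u. length (send A s N u) = B)"

definition mk_view :: "(nat \<Rightarrow> nat ugraph) \<Rightarrow> nat \<Rightarrow> observation list \<Rightarrow> local_view" where
  "mk_view G v h = Local_View v (if v \<in> verts (G 0) then Some (G 0) else None) h"

text \<open>The history of a node that is currently absent is empty, so a node inserted in round
  \<open>t + 1\<close> enters that round with empty history.\<close>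

primrec observations :: "algorithm \<Rightarrow> (nat \<Rightarrow> nat ugraph) \<Rightarrow> nat \<Rightarrow> nat \<Rightarrow> observation list" where
  "observations A G 0 = (\<lambda>v. [])"
| "observations A G (Suc t) = (\<lambda>v.
     if v \<in> verts (G (Suc t)) then
       observations A G t v @
         [(nbrs (G (Suc t)) v,
           \<lambda>u. if u \<in> nbrs (G (Suc t)) v
               then Some (send A (mk_view G u (observations A G t u)) (nbrs (G (Suc t)) u) v)
               else None)]
     else [])"

definition view_after :: "algorithm \<Rightarrow> (nat \<Rightarrow> nat ugraph) \<Rightarrow> nat \<Rightarrow> nat \<Rightarrow> local_view" where
  "view_after A G t v = mk_view G v (observations A G t v)"

section \<open>Membership listing and its bandwidth complexity\<close>

definition mem_list :: "'a ugraph \<Rightarrow> nat ugraph \<Rightarrow> nat \<Rightarrow> nat ugraph set" where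
  "mem_list H G v = {S. is_subgraph S G \<and> graph_iso S H \<and> v \<in> verts S}"

text \<open>
  Correctness is required at the end of round \<open>i + r - 1\<close> for every round \<open>i \<ge> 1\<close> that is followed
  by \<open>r - 1\<close> change-free rounds. By the promise this includes every round with a change; letting
  \<open>i\<close> also be a change-free round says that the output stays correct until the next change.
\<close>

definition solves_mem_list ::
  "change_type \<Rightarrow> 'a ugraph \<Rightarrow> nat \<Rightarrow> nat \<Rightarrow> algorithm \<Rightarrow> bool" where
  "solves_mem_list T H n r A \<longleftrightarrow>
     (\<forall>G. dynamic_network T n G \<and> promise r G \<longrightarrow>
        (\<forall>i\<ge>1. quiet_after r G i \<longrightarrow>
           (\<forall>v\<in>verts (G i). result A (view_after A G (i + r - 1) v) = mem_list H (G i) v)))"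

text \<open>The minimum is taken in \<^typ>\<open>enat\<close>, so that it is \<open>\<infinity>\<close> (and not an unspecified number)
  if no bandwidth suffices.\<close>

definition bandwidth_complexity :: "change_type \<Rightarrow> 'a ugraph \<Rightarrow> nat \<Rightarrow> nat \<Rightarrow> enat" where
  "bandwidth_complexity T H n r =
     (INF B\<in>{B. \<exists>A. has_bandwidth A B \<and> solves_mem_list T H n r A}. enat B)"

end

theory Submission
  imports Defs
begin

text \<open>
  Any two non-adjacent nodes of a complete multipartite graph lie in the same part, so every edge
  of a copy of \<open>H\<close> containing \<open>v\<close> has an endpoint adjacent to \<open>v\<close>. Hence \<open>v\<close> can list its copies
  as soon as it knows the neighborhoods of its neighbors. To maintain these, a node starts
  transmitting its neighborhood as a bit vector of length \<open>n\<close> whenever its neighbor list changes,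
  in chunks of \<open>O(n/r)\<close> bits over \<open>r\<close> rounds; one further bit per message marks the first chunk.
  If an edge \<open>{x, v}\<close> is new, then the neighbor list of \<open>x\<close> has changed, so \<open>v\<close> never misses the
  last transmission of a current neighbor \<open>x\<close>. This works for all four types of change.
\<close>

section \<open>Copies of complete multipartite graphs\<close>

text \<open>Non-adjacency means lying in a common part; by disjointness the two parts that share
  \<open>v\<close> coincide.\<close>

lemma nonadjacent_trans:
  assumes "complete_multipartite H" "u \<in> verts H" "v \<in> verts H" "w \<in> verts H"
    and "\<not> adjacent H u v" "\<not> adjacent H v w"
  shows "\<not> adjacent H u w"
proof -
  obtain P where P: "partition_on (verts H) P"
    and adj: "\<forall>u\<in>verts H. \<forall>v\<in>verts H. adjacent H u v \<longleftrightarrow> \<not> (\<exists>S\<in>P. u \<in> S \<and> v \<in> S)"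
    using assms(1) unfolding complete_multipartite_def by blast
  obtain S1 where S1: "S1 \<in> P" "u \<in> S1" "v \<in> S1"
    using adj assms(2,3,5) by meson
  obtain S2 where S2: "S2 \<in> P" "v \<in> S2" "w \<in> S2"
    using adj assms(3,4,6) by meson
  have "S1 = S2"
    using S1 S2 partition_onD2[OF P] by (meson disjointD disjoint_iff)
  then show ?thesis
    using S1 S2 adj assms(2,4) by blast
qed

lemma adjacent_vertsD:
  assumes "simple_graph G" "adjacent G u v"
  shows "u \<in> verts G" "v \<in> verts G" "u \<noteq> v"
  using assms unfolding simple_graph_def adjacent_def by fastforce+

lemma connected_imp_neighbor:
  assumes "simple_graph H" "graph_connected H" "card (verts H) \<ge> 2" "u \<in> verts H"
  obtains w where "w \<in> verts H" "adjacent H u w"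
proof -
  have "\<not> verts H \<subseteq> {u}"
    using assms(3) card_mono[of "{u}" "verts H"] by auto
  then obtain z where "z \<in> verts H" "z \<noteq> u" by blast
  with assms(2,4) have "(adjacent H)\<^sup>*\<^sup>* u z" unfolding graph_connected_def by blast
  with \<open>z \<noteq> u\<close> obtain w where "adjacent H u w" by (metis converse_rtranclpE)
  with that show ?thesis using adjacent_vertsD[OF assms(1)] by blast
qed

text \<open>The left-hand graph is what \<open>v\<close> can reconstruct from its neighbors.
  \<open>UNIV\<close> may replace \<open>verts G\<close>, which \<open>v\<close> need not know: a
  connected \<open>H\<close> with at least two nodes has no isolated node, so the edges of a copy
  cover its nodes.\<close>

lemma mem_list_neighborhoods:
  assumes H: "simple_graph H" "graph_connected H" "complete_multipartite H" "card (verts H) \<ge> 2"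
    and G: "simple_graph G"
  shows "mem_list H (UNIV, {{x, y} | x y. x \<in> nbrs G v \<and> y \<in> nbrs G x}) v = mem_list H G v"
    (is "mem_list H (UNIV, ?E) v = _")
proof -
  have E: "?E \<subseteq> edges G"
    unfolding nbrs_def adjacent_def by (auto simp: insert_commute)
  have subgraph_iff: "is_subgraph S (UNIV, ?E) \<longleftrightarrow> is_subgraph S G"
    if iso: "graph_iso S H" and v: "v \<in> verts S" for S
  proof -
    obtain f where bij: "bij_betw f (verts S) (verts H)"
      and f: "\<forall>u\<in>verts S. \<forall>w\<in>verts S. adjacent S u w \<longleftrightarrow> adjacent H (f u) (f w)"
      using iso unfolding graph_iso_def by blast
    have fin: "f u \<in> verts H" if "u \<in> verts S" for u
      using bij that bij_betwE by blast
    have "verts S \<subseteq> \<Union> (edges S)"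
    proof
      fix u assume u: "u \<in> verts S"
      obtain w' where w': "w' \<in> verts H" "adjacent H (f u) w'"
        using connected_imp_neighbor[OF H(1,2,4) fin[OF u]] .
      then obtain w where "w \<in> verts S" "w' = f w"
        using bij by (metis bij_betw_imp_surj_on imageE)
      with f u w' have "adjacent S u w" by blast
      then show "u \<in> \<Union> (edges S)" unfolding adjacent_def by blast
    qed
    moreover have "\<Union> (edges G) \<subseteq> verts G"
      using G unfolding simple_graph_def by blast
    ultimately have "verts S \<subseteq> verts G" if "edges S \<subseteq> edges G"
      using that by blast
    moreover have "edges S \<subseteq> ?E" if S: "simple_graph S" and sub: "edges S \<subseteq> edges G"
    proof
      fix e assume e: "e \<in> edges S"
      then have "card e = 2" "e \<subseteq> verts S" using S unfolding simple_graph_def by auto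
      then obtain a b where ab: "e = {a, b}" "a \<in> verts S" "b \<in> verts S"
        by (auto simp: card_2_iff)
      have "adjacent S a b" using e ab unfolding adjacent_def by simp
      \<comment> \<open>If \<open>v\<close> were adjacent to neither endpoint,
        \<open>nonadjacent_trans\<close> would make \<open>a\<close> and \<open>b\<close>
        non-adjacent.\<close>
      then have "adjacent S v a \<or> adjacent S v b"
        using nonadjacent_trans[OF H(3), of "f a" "f v" "f b"] f fin v ab
        by (metis adjacent_def insert_commute)
      moreover have "a \<in> nbrs G b" "b \<in> nbrs G a"
        using e sub ab unfolding nbrs_def adjacent_def by (auto simp: insert_commute)
      moreover have "x \<in> nbrs G v" if "adjacent S v x" for x
        using that sub unfolding nbrs_def adjacent_def by (auto simp: insert_commute)
      ultimately show "e \<in> ?E"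
        unfolding ab(1) by (auto simp: insert_commute)
    qed
    ultimately show ?thesis
      using subset_trans[OF _ E, of "edges S"] unfolding is_subgraph_def by auto
  qed
  have "S \<in> mem_list H (UNIV, ?E) v \<longleftrightarrow> S \<in> mem_list H G v" for S
    unfolding mem_list_def mem_Collect_eq using subgraph_iff[of S] by argo
  then show ?thesis by (rule set_eqI)
qed

section \<open>The algorithm\<close>

text \<open>Index \<open>j\<close> counts the rounds since the node joined; \<open>j = length (history s)\<close> is the current
  round, whose neighbor list \<open>N\<close> is not yet part of the history.\<close>

definition list_changed :: "local_view \<Rightarrow> nat set \<Rightarrow> nat \<Rightarrow> bool" where
  "list_changed s N j \<longleftrightarrow>
     (let L = map fst (history s) @ [N]
      in if j = 0 then (case initial_graph s of None \<Rightarrow> True | Some g \<Rightarrow> nbrs g (own_id s) \<noteq> L ! 0)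
         else L ! j \<noteq> L ! (j - 1))"

definition chunk :: "nat \<Rightarrow> nat set \<Rightarrow> nat \<Rightarrow> bool list" where
  "chunk k N d = map (\<lambda>i. Suc (d * k + i) \<in> N) [0..<k]"

text \<open>If the list has never changed, then the \<open>LEAST\<close> is unspecified and the receiver ignores the
  chunk.\<close>

definition broadcast :: "nat \<Rightarrow> local_view \<Rightarrow> nat set \<Rightarrow> nat \<Rightarrow> message" where
  "broadcast k s N u =
     list_changed s N (length (history s)) #
     chunk k N (LEAST d. list_changed s N (length (history s) - d))"

definition starts :: "observation list \<Rightarrow> nat \<Rightarrow> nat set" where
  "starts h x = {j. j < length h \<and> (\<exists>m. snd (h ! j) x = Some (True # m))}"

text \<open>IDs start at 1, hence the shift by one. If a current neighbor has never sent a flag, the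
  edge dates back to \<open>G 0\<close>, so \<open>the\<close> is applied to an initial graph that
  the receiver does know.\<close>

definition decode :: "nat \<Rightarrow> nat \<Rightarrow> local_view \<Rightarrow> nat \<Rightarrow> nat set" where
  "decode n k s x =
     (let h = history s
      in if starts h x = {} then nbrs (the (initial_graph s)) x
         else {u \<in> {1..n}. tl (the (snd (h ! (Max (starts h x) + (u - 1) div k)) x)) ! ((u - 1) mod k)})"

definition listing_algorithm :: "'a ugraph \<Rightarrow> nat \<Rightarrow> nat \<Rightarrow> algorithm" where
  "listing_algorithm H n k =
     \<lparr>send = broadcast k,
      result = \<lambda>s. mem_list H (UNIV, {{x, y} | x y. x \<in> fst (last (history s)) \<and> y \<in> decode n k s x})
                 (own_id s)\<rparr>"

lemma has_bandwidth_listing_algorithm: "has_bandwidth (listing_algorithm H n k) (Suc k)"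
  by (simp add: has_bandwidth_def listing_algorithm_def broadcast_def chunk_def)

lemma chunk_nth:
  assumes "k > 0" "u \<ge> 1"
  shows "chunk k N ((u - 1) div k) ! ((u - 1) mod k) \<longleftrightarrow> u \<in> N"
  using assms by (simp add: chunk_def)

section \<open>Local views in a dynamic network\<close>

lemma simple_graph_topological_change:
  assumes "simple_graph G" "topological_change T G G'"
  shows "simple_graph G'"
proof (cases T)
  case Node_Insertion
  then obtain v N where v: "v \<notin> verts G" "N \<subseteq> verts G"
    and G': "G' = (insert v (verts G), edges G \<union> {{u, v} | u. u \<in> N})"
    using assms(2) by auto
  have "{u, v} \<subseteq> insert v (verts G) \<and> card {u, v} = 2" if "u \<in> N" for u
  proof -
    have "u \<in> verts G" "u \<noteq> v" using v that by auto
    then show ?thesis by simp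
  qed
  then show ?thesis using assms(1) unfolding G' simple_graph_def by auto
next
  case Node_Deletion
  then show ?thesis using assms by (fastforce simp: simple_graph_def)
next
  case Edge_Insertion
  then obtain u v where uv: "u \<in> verts G" "v \<in> verts G" "u \<noteq> v"
    and G': "G' = (verts G, insert {u, v} (edges G))"
    using assms(2) by auto
  then show ?thesis using assms(1) by (simp add: simple_graph_def)
next
  case Edge_Deletion
  then obtain e where "G' = (verts G, edges G - {e})"
    using assms(2) by auto
  then show ?thesis using assms(1) by (simp add: simple_graph_def)
qed

lemma topological_change_verts:
  assumes "topological_change T G G'"
  shows "if T = Node_Insertion then verts G \<subseteq> verts G' else verts G' \<subseteq> verts G"
  using assms by (cases T) auto

locale network =
  fixes T :: change_type and n :: nat and G :: "nat \<Rightarrow> nat ugraph"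
  assumes network: "dynamic_network T n G"
begin

lemma step: "G (Suc t) = G t \<or> topological_change T (G t) (G (Suc t))"
  using network unfolding dynamic_network_def by blast

lemma simple: "simple_graph (G t)"
proof (induction t)
  case 0
  then show ?case using network unfolding dynamic_network_def by blast
next
  case (Suc t)
  then show ?case
    using step simple_graph_topological_change by metis
qed

lemma verts_bound: "verts (G t) \<subseteq> {1..n}"
  using network unfolding dynamic_network_def by blast

lemma nbrs_verts: "u \<in> nbrs (G t) v \<Longrightarrow> u \<in> verts (G t) \<and> v \<in> verts (G t)"
  using adjacent_vertsD[OF simple] unfolding nbrs_def by blast

lemma nbrs_sym: "u \<in> nbrs (G t) v \<longleftrightarrow> v \<in> nbrs (G t) u"
  by (simp add: nbrs_def adjacent_def insert_commute)

text \<open>With a single type of change the node sets form a monotone sequence, so no node leaves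
  and returns.\<close>

lemma verts_convex:
  assumes "v \<in> verts (G s)" "v \<in> verts (G t)" "s \<le> u" "u \<le> t"
  shows "v \<in> verts (G u)"
proof (cases "T = Node_Insertion")
  case True
  then have "verts (G i) \<subseteq> verts (G (Suc i))" for i
    using step[of i] topological_change_verts[of T "G i" "G (Suc i)"] by auto
  then have "verts (G s) \<subseteq> verts (G u)"
    using assms(3) by (rule lift_Suc_mono_le)
  then show ?thesis using assms(1) by blast
next
  case False
  then have "verts (G (Suc i)) \<subseteq> verts (G i)" for i
    using step[of i] topological_change_verts[of T "G i" "G (Suc i)"] by auto
  then have "verts (G t) \<subseteq> verts (G u)"
    using assms(4) by (rule lift_Suc_antimono_le)
  then show ?thesis using assms(2) by blast
qed

text \<open>The first round that \<open>v\<close> observes. Round 0 has no communication, so nodes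
  of \<open>G 0\<close> that survive to round 1 join in round 1.\<close>

definition joined :: "nat \<Rightarrow> nat" where
  "joined v = (LEAST s. s \<ge> 1 \<and> v \<in> verts (G s))"

lemma joined:
  assumes "v \<in> verts (G t)" "t \<ge> 1"
  shows "joined v \<ge> 1" "joined v \<le> t" "v \<in> verts (G (joined v))"
  using LeastI[of "\<lambda>s. s \<ge> 1 \<and> v \<in> verts (G s)" t] Least_le[of "\<lambda>s. s \<ge> 1 \<and> v \<in> verts (G s)" t] assms
  unfolding joined_def by blast+

lemma not_before_joined:
  assumes "s < joined v" "s \<ge> 1"
  shows "v \<notin> verts (G s)"
  using assms not_less_Least unfolding joined_def by blast

lemma joined_initial:
  assumes "v \<in> verts (G t)" "t \<ge> 1" "v \<in> verts (G 0)"
  shows "joined v = 1"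
proof -
  have "v \<in> verts (G 1)" using verts_convex[OF assms(3,1)] assms(2) by blast
  then show ?thesis using joined[of v 1] by simp
qed

section \<open>Histories as intervals of rounds\<close>

definition obs :: "algorithm \<Rightarrow> nat \<Rightarrow> nat \<Rightarrow> observation" where
  "obs A v t = (nbrs (G t) v,
     \<lambda>u. if u \<in> nbrs (G t) v
         then Some (send A (mk_view G u (observations A G (t - 1) u)) (nbrs (G t) u) v) else None)"

lemma observations_Suc:
  "observations A G (Suc t) v =
     (if v \<in> verts (G (Suc t)) then observations A G t v @ [obs A v (Suc t)] else [])"
  unfolding obs_def diff_Suc_1 by simp

text \<open>This is the history from which \<open>v\<close> sends in round \<open>Suc t\<close>; for
  a node inserted in that very round the interval is empty.\<close>

lemma observations_eq:
  assumes "v \<in> verts (G (Suc t))"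
  shows "observations A G t v = map (obs A v) [joined v..<Suc t]"
  using assms
proof (induction t)
  case 0
  then show ?case using joined[of v "Suc 0"] by simp
next
  case (Suc t)
  show ?case
  proof (cases "v \<in> verts (G (Suc t))")
    case True
    then show ?thesis using Suc.IH joined[of v "Suc t"]
      by (simp add: observations_Suc del: observations.simps(2))
  next
    case False
    \<comment> \<open>By convexity \<open>v\<close> appears only in the next round, so both sides
      are empty.\<close>
    then have "\<not> joined v \<le> Suc t"
      using joined(3)[OF Suc.prems] Suc.prems verts_convex[of v "joined v" "Suc (Suc t)" "Suc t"]
      by auto
    then show ?thesis using False by (simp add: observations_Suc del: observations.simps(2))
  qed
qed

lemma history_eq:
  assumes "v \<in> verts (G t)" "t \<ge> 1"
  shows "observations A G t v = map (obs A v) [joined v..<Suc t]"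
proof -
  obtain t' where t: "t = Suc t'" using assms(2) by (cases t) auto
  show ?thesis
    using assms joined[OF assms] observations_eq[of v t' A] unfolding t
    by (simp add: observations_Suc del: observations.simps(2))
qed

section \<open>Changes of neighbor lists and the messages they trigger\<close>

definition nbrs_change :: "nat \<Rightarrow> nat \<Rightarrow> bool" where
  "nbrs_change v s \<longleftrightarrow> v \<notin> verts (G (s - 1)) \<or> nbrs (G s) v \<noteq> nbrs (G (s - 1)) v"

text \<open>Links the clock-free local test to global rounds. A newcomer counts as changed in both
  formulations, as it has no earlier list to compare with.\<close>

lemma list_changed_iff:
  assumes v: "v \<in> verts (G t)" and t: "t \<ge> 1" and s: "joined v \<le> s" "s \<le> t"
  shows "list_changed (mk_view G v (observations A G (t - 1) v)) (nbrs (G t) v) (s - joined v)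
           \<longleftrightarrow> nbrs_change v s"
proof -
  note j = joined[OF v t]
  have obs: "observations A G (t - 1) v = map (obs A v) [joined v..<t]"
    using observations_eq[of v "t - 1"] v t by simp
  have "map fst (observations A G (t - 1) v) @ [nbrs (G t) v]
      = map (\<lambda>s. nbrs (G s) v) [joined v..<Suc t]"
    using j unfolding obs by (simp add: obs_def)
  then have nth: "(map fst (observations A G (t - 1) v) @ [nbrs (G t) v]) ! i = nbrs (G (joined v + i)) v"
    if "joined v + i \<le> t" for i
    using that nth_upt[of "joined v" i "Suc t"] by (simp del: upt_Suc)
  show ?thesis
  proof (cases "s = joined v")
    case True
    show ?thesis
    proof (cases "v \<in> verts (G 0)")
      case True': True
      \<comment> \<open>Here \<open>joined v = 1\<close>, and the list for round 0 is read off the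
        stored \<open>G 0\<close>.\<close>
      then show ?thesis
        using joined_initial[OF v t] nth[of 0] j True
        by (auto simp: list_changed_def nbrs_change_def mk_view_def)
    next
      case False
      then have "v \<notin> verts (G (s - 1))"
        using not_before_joined[of "s - 1" v] True j by (cases "s = 1") auto
      then show ?thesis using False True
        by (simp add: list_changed_def nbrs_change_def mk_view_def)
    qed
  next
    case False
    then have "v \<in> verts (G (s - 1))"
      using verts_convex[OF j(3) v] s by simp
    then show ?thesis
      using False s nth[of "s - joined v"] nth[of "s - joined v - 1"]
      by (simp add: list_changed_def nbrs_change_def mk_view_def Let_def)
  qed
qed

text \<open>The broadcast in global time. The conditional mirrors truncated subtraction in
  \<open>broadcast\<close>, where going back beyond the first observed round stays at that
  round.\<close>

definition message_at :: "nat \<Rightarrow> nat \<Rightarrow> nat \<Rightarrow> message" where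
  "message_at k x t = nbrs_change x t #
     chunk k (nbrs (G t) x)
       (LEAST d. nbrs_change x (if d \<le> t - joined x then t - d else joined x))"

lemma broadcast_eq:
  assumes "x \<in> verts (G t)" "t \<ge> 1"
  shows "broadcast k (mk_view G x (observations A G (t - 1) x)) (nbrs (G t) x) v = message_at k x t"
proof -
  note j = joined[OF assms]
  let ?s = "mk_view G x (observations A G (t - 1) x)"
  have len: "length (history ?s) = t - joined x"
    using observations_eq[of x "t - 1" A] assms by (simp add: mk_view_def)
  have "list_changed ?s (nbrs (G t) x) (t - joined x - d)
      \<longleftrightarrow> nbrs_change x (if d \<le> t - joined x then t - d else joined x)" for d
    using list_changed_iff[OF assms, of "t - d" A] list_changed_iff[OF assms, of "joined x" A] j
    by (auto simp: algebra_simps)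
  from this this[of 0] show ?thesis
    unfolding broadcast_def message_at_def len by simp
qed

text \<open>The most recent change lies exactly \<open>d\<close> rounds back, so
  \<open>LEAST\<close> selects chunk \<open>d\<close>.\<close>

lemma message_at_after_change:
  assumes m: "m \<ge> joined x"
    and c: "nbrs_change x m" and nc: "\<And>s. m < s \<Longrightarrow> s \<le> m + d \<Longrightarrow> \<not> nbrs_change x s"
  shows "tl (message_at k x (m + d)) = chunk k (nbrs (G (m + d)) x) d"
proof -
  have "(LEAST d'. nbrs_change x (if d' \<le> m + d - joined x then m + d - d' else joined x)) = d"
  proof (rule Least_equality)
    fix d' assume d': "nbrs_change x (if d' \<le> m + d - joined x then m + d - d' else joined x)"
    show "d \<le> d'"
    proof (rule ccontr)
      assume "\<not> d \<le> d'"
      then have "d' \<le> m + d - joined x" "m < m + d - d'" "m + d - d' \<le> m + d"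
        using m by linarith+
      with d' nc[of "m + d - d'"] show False by simp
    qed
  qed (use c m in auto)
  then show ?thesis unfolding message_at_def by simp
qed

section \<open>Quiet periods, edge histories and decoding\<close>

lemma nbrs_change_imp_change_at:
  assumes "nbrs_change x m" "x \<in> verts (G m)" "m \<ge> 1"
  shows "change_at G m"
  using assms unfolding nbrs_change_def change_at_def by auto

lemma nbrs_unchanged:
  assumes "s \<le> t" "\<And>u. s < u \<Longrightarrow> u \<le> t \<Longrightarrow> \<not> nbrs_change x u"
  shows "nbrs (G s) x = nbrs (G t) x"
  using assms
proof (induction rule: dec_induct)
  case (step u)
  then have "\<not> nbrs_change x (Suc u)" by simp
  with step show ?case unfolding nbrs_change_def by simp
qed simp

lemma graph_unchanged:
  assumes "quiet_after r G i" "i \<le> t" "t \<le> i + r - 1"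
  shows "G t = G i"
  using assms(2,3)
proof (induction rule: dec_induct)
  case (step t)
  then have "\<not> change_at G (Suc t)" using assms(1) unfolding quiet_after_def by simp
  with step show ?case unfolding change_at_def by simp
qed simp

text \<open>Any edge was either present all the time or is noticed by both endpoints when it appears.\<close>

lemma edge_history:
  assumes "x \<in> nbrs (G t) v"
  obtains s where "s \<le> t" "\<forall>u. s \<le> u \<and> u \<le> t \<longrightarrow> x \<in> nbrs (G u) v"
    "s = 0 \<or> nbrs_change x s"
proof -
  define P where "P s \<longleftrightarrow> s \<le> t \<and> (\<forall>u. s \<le> u \<and> u \<le> t \<longrightarrow> x \<in> nbrs (G u) v)" for s
  define s where "s = (LEAST s. P s)"
  have "P t" using assms unfolding P_def by auto
  then have s: "P s" unfolding s_def by (rule LeastI)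
  have "nbrs_change x s" if "s \<noteq> 0"
  proof -
    have "\<not> P (s - 1)" using not_less_Least[of "s - 1" P] that unfolding s_def by simp
    then obtain u where "s - 1 \<le> u" "u \<le> t" "x \<notin> nbrs (G u) v"
      using s unfolding P_def by auto
    moreover from this s have "\<not> s \<le> u" unfolding P_def by blast
    ultimately have "u = s - 1" by simp
    with \<open>x \<notin> nbrs (G u) v\<close> have "v \<notin> nbrs (G (s - 1)) x" using nbrs_sym by blast
    moreover have "v \<in> nbrs (G s) x" using s nbrs_sym unfolding P_def by blast
    ultimately show ?thesis unfolding nbrs_change_def by blast
  qed
  with s that[of s] show ?thesis unfolding P_def by blast
qed

text \<open>Without a flag, the list of \<open>x\<close> is still that of \<open>G 0\<close>.
  Otherwise the last flag was sent by round \<open>i\<close>, because the later rounds up to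
  \<open>t\<close> are quiet; this leaves \<open>r\<close> rounds for the chunks, and the list stays
  fixed meanwhile.\<close>

lemma decode_correct:
  assumes quiet: "quiet_after r G i" and i: "i \<ge> 1" and r: "r \<ge> 1" and k: "n \<le> r * k" "k > 0"
    and t: "t = i + r - 1" and x: "x \<in> nbrs (G t) v"
  shows "decode n k (view_after (listing_algorithm H n k) G t v) x = nbrs (G t) x"
proof -
  let ?A = "listing_algorithm H n k"
  let ?h = "observations ?A G t v"
  have t1: "t \<ge> 1" "i \<le> t" using t i r by auto
  have v: "v \<in> verts (G t)" using nbrs_verts[OF x] by blast
  note j = joined[OF v t1(1)]
  have h: "?h = map (obs ?A v) [joined v..<Suc t]"
    using history_eq[OF v t1(1)] .
  have len: "length ?h = Suc t - joined v" unfolding h using j by (simp add: Suc_diff_le)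
  have msg: "snd (?h ! (s - joined v)) x
      = (if x \<in> nbrs (G s) v then Some (message_at k x s) else None)"
    if "joined v \<le> s" "s \<le> t" for s
  proof -
    have "?h ! (s - joined v) = obs ?A v s"
      using that unfolding h by (simp add: less_Suc_eq_le nth_upt Suc_diff_le del: upt_Suc)
    moreover have "s \<ge> 1" using that j by simp
    ultimately show ?thesis
      using broadcast_eq[of x s k ?A v] nbrs_verts[of x s v]
      by (simp add: obs_def listing_algorithm_def)
  qed
  \<comment> \<open>The global rounds in which \<open>v\<close> receives a flag from
    \<open>x\<close>.\<close>
  define K where "K = {s. joined v \<le> s \<and> s \<le> t \<and> x \<in> nbrs (G s) v \<and> nbrs_change x s}"
  have flag: "(\<exists>m. snd (?h ! (s - joined v)) x = Some (True # m)) \<longleftrightarrow> s \<in> K"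
    if "joined v \<le> s" "s \<le> t" for s
    unfolding msg[OF that] K_def using that by (simp add: message_at_def)
  have starts: "starts ?h x = (\<lambda>s. s - joined v) ` K"
  proof (rule set_eqI)
    fix a
    have "a \<in> starts ?h x \<longleftrightarrow> joined v + a \<le> t \<and> joined v + a \<in> K"
      using flag[of "joined v + a"] len unfolding starts_def by auto
    also have "\<dots> \<longleftrightarrow> a \<in> (\<lambda>s. s - joined v) ` K"
    proof
      assume "joined v + a \<le> t \<and> joined v + a \<in> K"
      then show "a \<in> (\<lambda>s. s - joined v) ` K" by (intro image_eqI[of _ _ "joined v + a"]) auto
    next
      assume "a \<in> (\<lambda>s. s - joined v) ` K"
      then obtain s where "s \<in> K" "a = s - joined v" by blast
      then show "joined v + a \<le> t \<and> joined v + a \<in> K" unfolding K_def by simp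
    qed
    finally show "a \<in> starts ?h x \<longleftrightarrow> a \<in> (\<lambda>s. s - joined v) ` K" .
  qed
  have view: "history (view_after ?A G t v) = ?h"
    "initial_graph (view_after ?A G t v) = (if v \<in> verts (G 0) then Some (G 0) else None)"
    by (simp_all add: view_after_def mk_view_def)
  obtain s0 where s0: "s0 \<le> t" "\<forall>u. s0 \<le> u \<and> u \<le> t \<longrightarrow> x \<in> nbrs (G u) v"
    "s0 = 0 \<or> nbrs_change x s0"
    using edge_history[OF x] .
  \<comment> \<open>The change that created the edge is flagged over the edge itself, in the same
    round.\<close>
  have s0K: "s0 \<in> K" if "s0 \<noteq> 0"
  proof -
    have "x \<in> nbrs (G s0) v" using s0 by blast
    then show ?thesis using s0 that joined(2)[of v s0] nbrs_verts unfolding K_def by auto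
  qed
  show ?thesis
  proof (cases "K = {}")
    case True
    with s0K have "s0 = 0" by blast
    with s0(1,2) have "x \<in> nbrs (G 0) v" by blast
    then have v0: "v \<in> verts (G 0)" using nbrs_verts by blast
    then have "joined v = 1" using joined_initial[OF v t1(1)] by blast
    \<comment> \<open>The edge has existed since round 0, so any change at \<open>x\<close> would
      have put its round into \<open>K\<close>.\<close>
    then have "\<not> nbrs_change x u" if "0 < u" "u \<le> t" for u
      using True that s0(2) \<open>s0 = 0\<close> \<open>joined v = 1\<close> unfolding K_def by auto
    then have "nbrs (G 0) x = nbrs (G t) x" by (intro nbrs_unchanged) auto
    then show ?thesis using True v0 unfolding decode_def view Let_def starts by simp
  next
    case False
    have fin: "finite K" by (rule finite_subset[of _ "{..t}"]) (auto simp: K_def)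
    define m where "m = Max K"
    have mK: "m \<in> K" unfolding m_def using fin False by simp
    \<comment> \<open>Hence the edge exists throughout \<open>m\<close> to \<open>t\<close>, and no
      chunk sent after the last flag is lost.\<close>
    have s0m: "s0 \<le> m" using s0K fin unfolding m_def by (cases "s0 = 0") auto
    have max: "Max (starts ?h x) = m - joined v"
      unfolding starts m_def
      by (rule mono_Max_commute[symmetric]) (auto simp: mono_def diff_le_mono fin False)
    have m: "joined v \<le> m" "m \<le> t" "nbrs_change x m" "m \<ge> 1"
      using mK j unfolding K_def by auto
    have adj: "x \<in> nbrs (G u) v" if "m \<le> u" "u \<le> t" for u
      using s0(2) s0m that by simp
    have nc: "\<not> nbrs_change x u" if "m < u" "u \<le> t" for u
    proof
      assume "nbrs_change x u"
      with that adj[of u] m have "u \<in> K" unfolding K_def by simp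
      then have "u \<le> m" using fin unfolding m_def by simp
      with that show False by simp
    qed
    have xm: "x \<in> verts (G m)" using adj[of m] m nbrs_verts by blast
    have change: "change_at G m" using nbrs_change_imp_change_at m xm by blast
    \<comment> \<open>A changed list requires a topological change, and rounds \<open>i + 1\<close>
      to \<open>t\<close> have none.\<close>
    have "m \<le> i"
    proof (rule ccontr)
      assume "\<not> m \<le> i"
      then have "m \<in> {i + 1..i + r - 1}" using m t by simp
      with quiet change show False unfolding quiet_after_def by blast
    qed
    have bit: "tl (the (snd (?h ! (m - joined v + (u - 1) div k)) x)) ! ((u - 1) mod k)
        \<longleftrightarrow> u \<in> nbrs (G t) x" if u: "1 \<le> u" "u \<le> n" for u
    proof -
      let ?d = "(u - 1) div k"
      \<comment> \<open>From \<open>u - 1 < n\<close> and \<open>n \<le> r * k\<close>; so chunk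
        \<open>?d\<close> arrives by round \<open>i + r - 1\<close>.\<close>
      have "?d < r" using u k by (simp add: less_mult_imp_div_less)
      then have d: "m + ?d \<le> t" using t \<open>m \<le> i\<close> by simp
      have "snd (?h ! (m - joined v + ?d)) x = Some (message_at k x (m + ?d))"
        using msg[of "m + ?d"] m d adj[of "m + ?d"] by simp
      moreover have "tl (message_at k x (m + ?d)) = chunk k (nbrs (G (m + ?d)) x) ?d"
      proof (rule message_at_after_change)
        show "joined x \<le> m" using joined[OF xm m(4)] by simp
      qed (use m nc d in auto)
      \<comment> \<open>Each chunk encodes the list at its own sending time, but all these lists
        agree.\<close>
      moreover have "nbrs (G (m + ?d)) x = nbrs (G t) x"
        using d nc by (intro nbrs_unchanged) auto
      ultimately show ?thesis using chunk_nth[OF k(2) u(1)] by simp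
    qed
    have "nbrs (G t) x \<subseteq> {1..n}" using nbrs_verts verts_bound by blast
    then show ?thesis
      using False bit unfolding decode_def view Let_def max
      by (auto simp: starts)
  qed
qed

end

section \<open>Correctness of the algorithm and the bandwidth bound\<close>

lemma solves_listing_algorithm:
  assumes H: "simple_graph H" "graph_connected H" "complete_multipartite H" "card (verts H) \<ge> 2"
    and r: "r \<ge> 1" and k: "n \<le> r * k" "k > 0"
  shows "solves_mem_list T H n r (listing_algorithm H n k)"
  unfolding solves_mem_list_def
proof (intro allI impI ballI; elim conjE)
  fix G i v
  assume G: "dynamic_network T n G" and i: "i \<ge> 1" "quiet_after r G i" and v: "v \<in> verts (G i)"
  interpret network T n G using G by (rule network.intro)
  let ?A = "listing_algorithm H n k"
  define t where "t = i + r - 1"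
  have t1: "t \<ge> 1" "i \<le> t" using t_def i r by auto
  have eq: "G t = G i" by (rule graph_unchanged[OF i(2) t1(2)]) (simp add: t_def)
  let ?s = "view_after ?A G t v"
  have s: "own_id ?s = v" "fst (last (history ?s)) = nbrs (G t) v"
    using history_eq[of v t ?A] joined[of v t] v eq t1
    by (auto simp: view_after_def mk_view_def obs_def)
  have decode: "decode n k ?s x = nbrs (G t) x" if "x \<in> nbrs (G t) v" for x
    using decode_correct[OF i(2,1) r k t_def that] .
  have "{{x, y} | x y. x \<in> nbrs (G t) v \<and> y \<in> decode n k ?s x}
      = {{x, y} | x y. x \<in> nbrs (G t) v \<and> y \<in> nbrs (G t) x}"
    by (intro Collect_cong ex_cong1 conj_cong refl) (simp add: decode)
  then have "result ?A ?s = mem_list H (G t) v"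
    using mem_list_neighborhoods[OF H simple[of t], of v] s
    by (simp add: listing_algorithm_def)
  then show "result ?A (view_after ?A G (i + r - 1) v) = mem_list H (G i) v"
    using eq t_def by simp
qed

theorem theorem5p1:
  fixes H :: "'a ugraph" and T :: change_type
  assumes "simple_graph H"
    and "graph_connected H"
    and "complete_multipartite H"
    and "card (verts H) \<ge> 3"
  shows "\<exists>C::real. \<forall>n r :: nat. n \<ge> 1 \<longrightarrow> r \<ge> 1 \<longrightarrow>
           ereal_of_enat (bandwidth_complexity T H n r) \<le> ereal (C * max 1 (real n / real r))"
proof (intro exI[of _ 3] allI impI)
  fix n r :: nat
  assume r: "r \<ge> 1"
  \<comment> \<open>Exceeds \<open>n / r\<close>, so \<open>r\<close> chunks cover all IDs, and is
    positive even if \<open>n < r\<close>.\<close>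
  define k where "k = Suc (n div r)"
  have "n \<le> r * k"
    using r unfolding k_def by (simp add: dividend_less_times_div less_imp_le)
  then have "solves_mem_list T H n r (listing_algorithm H n k)"
    using assms r by (intro solves_listing_algorithm) (auto simp: k_def)
  then have "bandwidth_complexity T H n r \<le> enat (Suc k)"
    unfolding bandwidth_complexity_def using has_bandwidth_listing_algorithm
    by (intro INF_lower) blast
  then have "ereal_of_enat (bandwidth_complexity T H n r) \<le> ereal (real (Suc k))"
    by (metis ereal_of_enat_le_iff ereal_of_enat_simps(1))
  \<comment> \<open>\<open>Suc k\<close> is \<open>n div r + 2\<close>: one extra bit for rounding
    and one for the flag. Each of the three summands is at most the maximum, whence the constant
    3.\<close>
  also have "real (Suc k) \<le> 3 * max 1 (real n / real r)"
    using of_nat_div_le_of_nat[where ?'a = real, of n r] unfolding k_def by simp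
  finally show "ereal_of_enat (bandwidth_complexity T H n r) \<le> ereal (3 * max 1 (real n / real r))"
    by simp
qed

end
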